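(* Let $p>0$ be a constant, and let $q:\mathbb{R}\to\mathbb{R}$ be $2\pi$-periodic with $q(x)\ge0$ and $\overline q>0$, and such that $q''$ is piecewise $C^1$. Then there exists a constant $C_q$, independent of $N$ and $\Delta t$, such that for every even positive integer $N$ and every $\Delta t>0$ the approximate solution operator $S_N(\Delta t)$ of the two-node block Krylov subspace spectral (KSS) method with prescribed nodes, applied to $u_{tt}=p\,u_{xx}-q(x)u$ on $(0,2\pi)$ with periodic boundary conditions, satisfies $$\|S_N(\Delta t)\|_{C_N}\le 1+C_q\|\tilde q\|_\infty\Delta t .$$
   Context: Coefficients. "$q''$ is piecewise $C^1$" means that $q$ and $q'$ are continuous as $2\pi$-periodic functions and the second derivative $q''$ is a piecewise $C^1$ function (finitely many pieces per period, $C^1$ up to the endpoints of each piece). $\overline q$ is the average of $q$ over $[0,2\pi]$, $\overline p=p$; $\tilde q=q-\overline q$; $\|\cdot\|_\infty$ of a function is its sup norm. Grid. $N$ is even, $\Delta x=2\pi/N$, grid points $x_j=j\Delta x$, $j=0,\dots,N-1$; wave numbers $\omega\in\hat I_N=\{-N/2+1,\dots,N/2\}$. The discrete Fourier transform is the $N\times N$ matrix $F_N$ with entries $[F_N]_{\omega,j}=\frac1N e^{-i\omega x_j}$ (rows indexed by $\omega\in\hat I_N$). $D_N=F_N^{-1}\,\mathrm{diag}(i\omega)_{\omega\in\hat I_N}F_N$ is the Fourier first-derivative matrix. $Q_N$ is the diagonal matrix of values of $q$ at the grid points, and $L_N=-p\,D_N^2+Q_N$ is the discretization of $Lu=-p\,u_{xx}+q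 u$. KSS operator. Let $f_{11}(\lambda)=f_{22}(\lambda)=\cos(\lambda^{1/2}\Delta t)$, $f_{12}(\lambda)=\lambda^{-1/2}\sin(\lambda^{1/2}\Delta t)$, $f_{21}(\lambda)=-\lambda f_{12}(\lambda)$, with values at $\lambda=0$ defined by continuity. For $\omega\in\hat I_N$ the nodes are $l_{1,\omega}=0$ and $l_{2,\omega}=\overline p\,\omega^2+\overline q$, and $M_{ij,\omega}=\frac{f_{ij}(l_{2,\omega})-f_{ij}(l_{1,\omega})}{l_{2,\omega}-l_{1,\omega}}$. For $i,j\in\{1,2\}$, $S_{N,ij}(\Delta t)$ is the $N\times N$ matrix such that for every vector $\mathbf w\in\mathbb C^N$ and every $\omega\in\hat I_N$, $$[F_NS_{N,ij}(\Delta t)\mathbf w]_\omega=f_{ij}(l_{2,\omega})[F_N\mathbf w]_\omega+M_{ij,\omega}\,[F_N(L_N-l_{2,\omega}I)\mathbf w]_\omega .$$ $S_N(\Delta t)$ is the $2N\times2N$ block matrix with blocks $S_{N,ij}(\Delta t)$; one time step of the method maps $(\mathbf u^n,\mathbf u^n_t)$ to $S_N(\Delta t)(\mathbf u^n,\mathbf u_t^n)$. Norm. $C_N=F_N^{-1}\,\mathrm{diag}(\overline p\,\omega^2+\overline q)_{\omega\in\hat I_N}F_N$, the discretization of $C=-\overline p\,\partial_{xx}+\overline q I$. The $C_N$-norm is $\|(\mathbf u,\mathbf v)\|_{C_N}^2=\mathbf u^HC_N\mathbf u+\|\mathbf v\|_2^2$, and $\|S_N(\Delta t)\|_{C_N}$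 is the induced operator norm. *)

theory Defs
  imports
    "HOL-Analysis.Analysis"
    "Jordan_Normal_Form.Gauss_Jordan_Elimination"
    "Jordan_Normal_Form.Determinant"
begin

unbundle no vec_syntax

section \<open>Coefficients\<close>

text \<open>Only the open pieces constrain \<open>g\<close>, so jumps (and arbitrary values) at the breakpoints are
  allowed; \<open>h\<close> is the \<open>C\<^sup>1\<close> extension of \<open>g\<close> to the closed piece, with one-sided derivatives at
  its endpoints.  A partition of any other period can be refined and shifted to one of
  \<open>[0, 2 * pi]\<close>.\<close>

definition piecewise_C1 :: "(real \<Rightarrow> real) \<Rightarrow> bool" where
  "piecewise_C1 g \<longleftrightarrow>
     (\<exists>(n::nat) (t::nat \<Rightarrow> real). t 0 = 0 \<and> t n = 2 * pi \<and> (\<forall>i<n. t i < t (Suc i)) \<and>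
       (\<forall>i<n. \<exists>h h'.
          (\<forall>x\<in>{t i..t (Suc i)}. (h has_real_derivative h' x) (at x within {t i..t (Suc i)})) \<and>
          continuous_on {t i..t (Suc i)} h' \<and>
          (\<forall>x\<in>{t i<..<t (Suc i)}. g x = h x)))"

definition second_deriv_piecewise_C1 :: "(real \<Rightarrow> real) \<Rightarrow> bool" where
  "second_deriv_piecewise_C1 q \<longleftrightarrow>
     (\<exists>q' q''. (\<forall>x. (q has_real_derivative q' x) (at x)) \<and> continuous_on UNIV q' \<and>
        (\<exists>E. finite E \<and> (\<forall>x\<in>{0..2*pi} - E. (q' has_real_derivative q'' x) (at x))) \<and>
        piecewise_C1 q'')"

definition average :: "(real \<Rightarrow> real) \<Rightarrow> real" where
  "average q = integral {0..2*pi} q / (2 * pi)"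

definition fluct :: "(real \<Rightarrow> real) \<Rightarrow> real \<Rightarrow> real" where
  "fluct q x = q x - average q"

definition sup_norm :: "(real \<Rightarrow> real) \<Rightarrow> real" where
  "sup_norm f = (SUP x. \<bar>f x\<bar>)"


section \<open>Fourier discretization\<close>

definition grid :: "nat \<Rightarrow> nat \<Rightarrow> real" where
  "grid N j = real j * (2 * pi / real N)"

text \<open>Matrices are indexed from \<open>0\<close>; row \<open>k < N\<close> of the transform carries the \<open>k\<close>-th element
  of \<open>{- N/2 + 1 .. N/2}\<close>, in increasing order.\<close>

definition wavenum :: "nat \<Rightarrow> nat \<Rightarrow> int" where
  "wavenum N k = int k - int N div 2 + 1"

definition dft :: "nat \<Rightarrow> complex mat" where
  "dft N = mat N N (\<lambda>(k, j).
     exp (- \<i> * of_int (wavenum N k) * of_real (grid N j)) / of_nat N)"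

text \<open>The option result of \<^const>\<open>mat_inverse\<close> is always \<^const>\<open>Some\<close> here, see
  \<open>idft_inverse\<close> below.\<close>

definition idft :: "nat \<Rightarrow> complex mat" where
  "idft N = the (mat_inverse (dft N))"

definition diff_mat :: "nat \<Rightarrow> complex mat" where
  "diff_mat N = idft N * mat_diag N (\<lambda>k. \<i> * of_int (wavenum N k)) * dft N"

definition L_mat :: "real \<Rightarrow> (real \<Rightarrow> real) \<Rightarrow> nat \<Rightarrow> complex mat" where
  "L_mat p q N = complex_of_real (- p) \<cdot>\<^sub>m (diff_mat N ^\<^sub>m 2)
     + mat_diag N (\<lambda>j. complex_of_real (q (grid N j)))"


section \<open>The KSS time-stepping operator\<close>

definition f11 :: "real \<Rightarrow> real \<Rightarrow> real" where
  "f11 dt l = cos (sqrt l * dt)"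

text \<open>At \<open>l = 0\<close>: the limit of \<open>sin (sqrt l * dt) / sqrt l\<close>.\<close>

definition f12 :: "real \<Rightarrow> real \<Rightarrow> real" where
  "f12 dt l = (if l = 0 then dt else sin (sqrt l * dt) / sqrt l)"

definition f21 :: "real \<Rightarrow> real \<Rightarrow> real" where
  "f21 dt l = - l * f12 dt l"

definition f22 :: "real \<Rightarrow> real \<Rightarrow> real" where
  "f22 dt l = cos (sqrt l * dt)"

definition node1 :: real where
  "node1 = 0"

definition node2 :: "real \<Rightarrow> (real \<Rightarrow> real) \<Rightarrow> nat \<Rightarrow> nat \<Rightarrow> real" where
  "node2 p q N k = p * (of_int (wavenum N k))\<^sup>2 + average q"

definition slope :: "real \<Rightarrow> (real \<Rightarrow> real) \<Rightarrow> nat \<Rightarrow> (real \<Rightarrow> real) \<Rightarrow> nat \<Rightarrow> real" where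
  "slope p q N f k = (f (node2 p q N k) - f node1) / (node2 p q N k - node1)"

text \<open>The block of the solution operator belonging to the component function \<open>f\<close>;
  existence and uniqueness are \<open>kss_block_ex1\<close> below.\<close>

definition is_kss_block ::
  "real \<Rightarrow> (real \<Rightarrow> real) \<Rightarrow> nat \<Rightarrow> (real \<Rightarrow> real) \<Rightarrow> complex mat \<Rightarrow> bool" where
  "is_kss_block p q N f S \<longleftrightarrow> S \<in> carrier_mat N N \<and>
     (\<forall>w\<in>carrier_vec N. \<forall>k<N.
        (dft N *\<^sub>v (S *\<^sub>v w)) $ k =
          complex_of_real (f (node2 p q N k)) * (dft N *\<^sub>v w) $ k
          + complex_of_real (slope p q N f k) *
            (dft N *\<^sub>v ((L_mat p q N - complex_of_real (node2 p q N k) \<cdot>\<^sub>m 1\<^sub>m N) *\<^sub>v w)) $ k)"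

definition kss_block ::
  "real \<Rightarrow> (real \<Rightarrow> real) \<Rightarrow> nat \<Rightarrow> (real \<Rightarrow> real) \<Rightarrow> complex mat" where
  "kss_block p q N f = (THE S. is_kss_block p q N f S)"

definition kss_operator :: "real \<Rightarrow> (real \<Rightarrow> real) \<Rightarrow> nat \<Rightarrow> real \<Rightarrow> complex mat" where
  "kss_operator p q N dt = four_block_mat
     (kss_block p q N (f11 dt)) (kss_block p q N (f12 dt))
     (kss_block p q N (f21 dt)) (kss_block p q N (f22 dt))"


section \<open>The energy norm\<close>

definition C_mat :: "real \<Rightarrow> (real \<Rightarrow> real) \<Rightarrow> nat \<Rightarrow> complex mat" where
  "C_mat p q N = idft N *
     mat_diag N (\<lambda>k. complex_of_real (p * (of_int (wavenum N k))\<^sup>2 + average q)) * dft N"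

text \<open>A vector of length \<open>2 * N\<close> is the pair \<open>(u, v)\<close> of its two halves.  Since \<open>(\<bullet>c)\<close> conjugates
  its second argument, \<open>C u \<bullet>c u\<close> is \<open>u\<^sup>H C u\<close>.\<close>

definition C_norm :: "real \<Rightarrow> (real \<Rightarrow> real) \<Rightarrow> nat \<Rightarrow> complex vec \<Rightarrow> real" where
  "C_norm p q N z = (let u = vec_first z N; v = vec_last z N in
     sqrt (Re ((C_mat p q N *\<^sub>v u) \<bullet>c u) + Re (v \<bullet>c v)))"

definition C_opnorm :: "real \<Rightarrow> (real \<Rightarrow> real) \<Rightarrow> nat \<Rightarrow> complex mat \<Rightarrow> real" where
  "C_opnorm p q N A =
     (SUP z \<in> carrier_vec (2 * N) - {0\<^sub>v (2 * N)}. C_norm p q N (A *\<^sub>v z) / C_norm p q N z)"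


section \<open>Well-definedness\<close>

lemma sum_roots_of_unity:
  fixes m :: int
  assumes "N > 0" "\<not> int N dvd m"
  shows "(\<Sum>j<N. exp (\<i> * of_int m * of_real (grid N j))) = 0"
proof -
  define z where "z = exp (\<i> * of_int m * of_real (2 * pi / real N))"
  have pw: "exp (\<i> * of_int m * of_real (grid N j)) = z ^ j" for j
    unfolding z_def grid_def exp_of_nat_mult[symmetric] by (simp add: algebra_simps)
  have zN: "z ^ N = 1"
  proof -
    have "z ^ N = exp (of_nat N * (\<i> * of_int m * of_real (2 * pi / real N)))"
      unfolding z_def by (rule exp_of_nat_mult[symmetric])
    also have "of_nat N * (\<i> * of_int m * of_real (2 * pi / real N)) = 2 * of_int m * of_real pi * \<i>"
      using assms(1) by (simp add: field_simps)
    also have "exp \<dots> = 1"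
      by (subst exp_eq_1) (auto intro!: exI[of _ m])
    finally show ?thesis .
  qed
  have z1: "z \<noteq> 1"
  proof
    assume "z = 1"
    then obtain n :: int where "real_of_int m * (2 * pi / real N) = of_int (2 * n) * pi"
      unfolding z_def exp_eq_1 by auto
    hence "real_of_int m = of_int n * real N"
      using assms(1) by (simp add: field_simps)
    hence "m = n * int N"
      by (metis of_int_eq_iff of_int_mult of_int_of_nat_eq)
    thus False using assms(2) by simp
  qed
  show ?thesis
    unfolding pw using z1 zN by (simp add: geometric_sum)
qed

lemma dft_carrier: "dft N \<in> carrier_mat N N"
  by (simp add: dft_def)

lemma dft_mult_adjoint:
  assumes "N > 0"
  defines "G \<equiv> mat N N (\<lambda>(j, k). exp (\<i> * of_int (wavenum N k) * of_real (grid N j)))"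
  shows "dft N * G = 1\<^sub>m N"
proof (rule eq_matI)
  fix k l assume "k < dim_row (1\<^sub>m N :: complex mat)" "l < dim_col (1\<^sub>m N :: complex mat)"
  hence kl: "k < N" "l < N" by auto
  have "(dft N * G) $$ (k, l) =
      (\<Sum>j<N. exp (\<i> * of_int (int l - int k) * of_real (grid N j)) / of_nat N)"
    using kl by (auto simp: dft_def G_def scalar_prod_def wavenum_def lessThan_atLeast0
        exp_add[symmetric] algebra_simps intro!: sum.cong)
  also have "\<dots> = (\<Sum>j<N. exp (\<i> * of_int (int l - int k) * of_real (grid N j))) / of_nat N"
    by (simp add: sum_divide_distrib)
  also have "\<dots> = (if k = l then 1 else 0)"
  proof (cases "k = l")
    case False
    have "\<not> int N dvd int l - int k"
    proof
      assume "int N dvd int l - int k"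
      hence "int l mod int N = int k mod int N" by (simp add: mod_eq_dvd_iff)
      thus False using kl False by simp
    qed
    from sum_roots_of_unity[OF assms(1) this] False show ?thesis
      by (simp only: if_False div_0)
  qed (use assms in simp)
  finally show "(dft N * G) $$ (k, l) = 1\<^sub>m N $$ (k, l)" using kl by simp
qed (auto simp: dft_def G_def)

lemma idft_inverse:
  assumes "N > 0"
  shows "dft N * idft N = 1\<^sub>m N" "idft N * dft N = 1\<^sub>m N" "idft N \<in> carrier_mat N N"
proof -
  define G where "G = mat N N (\<lambda>(j, k). exp (\<i> * of_int (wavenum N k) * of_real (grid N j)))"
  have G: "G \<in> carrier_mat N N" "dft N * G = 1\<^sub>m N"
    using dft_mult_adjoint[OF assms] by (auto simp: G_def)
  have "G * dft N = 1\<^sub>m N"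
    using mat_mult_left_right_inverse[OF dft_carrier G] .
  with G have "dft N \<in> Units (ring_mat TYPE(complex) N ())"
    by (auto simp: Units_def ring_mat_def dft_carrier intro!: bexI[of _ G])
  then obtain B where B: "mat_inverse (dft N) = Some B"
    using mat_inverse(1)[OF dft_carrier, of N "()"] by (cases "mat_inverse (dft N)") auto
  show "dft N * idft N = 1\<^sub>m N" "idft N * dft N = 1\<^sub>m N" "idft N \<in> carrier_mat N N"
    using mat_inverse(2)[OF dft_carrier B] by (auto simp: idft_def B)
qed

lemma L_mat_carrier:
  assumes "N > 0"
  shows "L_mat p q N \<in> carrier_mat N N"
proof -
  have "diff_mat N \<in> carrier_mat N N"
    unfolding diff_mat_def using idft_inverse(3)[OF assms] dft_carrier
    by (auto intro!: mult_carrier_mat[of _ N N])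
  thus ?thesis by (auto simp: L_mat_def intro!: add_carrier_mat)
qed

lemma kss_block_ex1:
  assumes N: "N > 0"
  shows "\<exists>!S. is_kss_block p q N f S"
proof -
  note F = dft_carrier[of N] and G = idft_inverse[OF N] and L = L_mat_carrier[OF N, of p q]
  define T where "T = mat N N (\<lambda>(k, j). complex_of_real (f (node2 p q N k)) * dft N $$ (k, j)
     + complex_of_real (slope p q N f k) *
       (dft N * (L_mat p q N - complex_of_real (node2 p q N k) \<cdot>\<^sub>m 1\<^sub>m N)) $$ (k, j))"
  have T: "T \<in> carrier_mat N N" by (simp add: T_def)
  have rhs: "complex_of_real (f (node2 p q N k)) * (dft N *\<^sub>v w) $ k
          + complex_of_real (slope p q N f k) *
            (dft N *\<^sub>v ((L_mat p q N - complex_of_real (node2 p q N k) \<cdot>\<^sub>m 1\<^sub>m N) *\<^sub>v w)) $ k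
        = (T *\<^sub>v w) $ k" if w: "w \<in> carrier_vec N" and k: "k < N" for w k
  proof -
    define A where "A = L_mat p q N - complex_of_real (node2 p q N k) \<cdot>\<^sub>m 1\<^sub>m N"
    have A: "A \<in> carrier_mat N N" using L by (auto simp: A_def)
    hence FA: "dft N * A \<in> carrier_mat N N" using F by auto
    have "dft N *\<^sub>v (A *\<^sub>v w) = (dft N * A) *\<^sub>v w"
      using assoc_mult_mat_vec[OF F A w] by simp
    thus ?thesis
      using w k F FA unfolding A_def[symmetric]
      by (auto simp: T_def A_def[symmetric] scalar_prod_def sum_distrib_left sum.distrib[symmetric]
          algebra_simps simp del: index_mult_mat intro!: sum.cong)
  qed
  have iff: "is_kss_block p q N f S \<longleftrightarrow> S = idft N * T" for S
  proof
    assume "is_kss_block p q N f S"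
    hence S: "S \<in> carrier_mat N N"
      and *: "\<And>w k. w \<in> carrier_vec N \<Longrightarrow> k < N \<Longrightarrow> (dft N *\<^sub>v (S *\<^sub>v w)) $ k = (T *\<^sub>v w) $ k"
      by (auto simp: is_kss_block_def rhs)
    have "dft N * S = T"
    proof (rule eq_matI)
      fix k j assume "k < dim_row T" "j < dim_col T"
      hence kj: "k < N" "j < N" using T by auto
      have "(dft N *\<^sub>v (S *\<^sub>v unit_vec N j)) $ k = (T *\<^sub>v unit_vec N j) $ k"
        using * kj by simp
      also have "dft N *\<^sub>v (S *\<^sub>v unit_vec N j) = (dft N * S) *\<^sub>v unit_vec N j"
        using assoc_mult_mat_vec[OF F S, of "unit_vec N j"] by simp
      finally have "((dft N * S) *\<^sub>v unit_vec N j) $ k = (T *\<^sub>v unit_vec N j) $ k" .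
      moreover have "(M *\<^sub>v unit_vec N j) $ k = M $$ (k, j)" if "M \<in> carrier_mat N N"
        for M :: "complex mat"
        using that kj by simp
      ultimately show "(dft N * S) $$ (k, j) = T $$ (k, j)"
        using mult_carrier_mat[OF F S] T by metis
    qed (use F S T in auto)
    moreover have "S = idft N * (dft N * S)"
      using G S F by (simp flip: assoc_mult_mat)
    ultimately show "S = idft N * T" by simp
  next
    assume S: "S = idft N * T"
    have FT: "dft N * (idft N * T) = T" using G T F by (simp flip: assoc_mult_mat)
    have eq: "dft N *\<^sub>v (idft N * T *\<^sub>v w) = T *\<^sub>v w" if "w \<in> carrier_vec N" for w
      using assoc_mult_mat_vec[OF F mult_carrier_mat[OF G(3) T] that] FT by simp
    show "is_kss_block p q N f S"
      unfolding is_kss_block_def S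
    proof (intro conjI ballI allI impI)
      show "idft N * T \<in> carrier_mat N N" by (rule mult_carrier_mat[OF G(3) T])
    qed (simp only: eq rhs)
  qed
  show ?thesis unfolding iff by simp
qed

end

theory Submission
  imports Defs
begin

text \<open>Write \<open>l\<^sub>\<omega>\<close> for the second node.  Since \<open>L\<^sub>N = C\<^sub>N + diag (fluct q)\<close>, the defining relation
  of a block reduces to
  \<open>[F S\<^sub>f w]\<^sub>\<omega> = f(l\<^sub>\<omega>) [F w]\<^sub>\<omega> + M\<^sub>\<omega> [F (fluct q w)]\<^sub>\<omega>\<close>.  The first term is the exact propagator of
  the averaged equation: in each mode it rotates the pair \<open>(sqrt l\<^sub>\<omega> [F u]\<^sub>\<omega>, [F v]\<^sub>\<omega>)\<close>, whose norm
  is the energy norm of the mode, through the angle \<open>sqrt l\<^sub>\<omega> \<Delta>t\<close>.  The second term is a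
  perturbation of size \<open>O(\<Delta>t)\<close> uniformly in \<open>\<omega>\<close>, because \<open>|sin x| \<le> x\<close>, \<open>1 - cos x \<le> x\<close> for
  \<open>x \<ge> 0\<close> and \<open>l\<^sub>\<omega>\<close> is at least the average of \<open>q\<close>.  Parseval and Minkowski then give
  \<open>C\<^sub>q = 5 / sqrt (average q)\<close>.\<close>

section \<open>The discrete Fourier transform\<close>

text \<open>A one-sided inverse of an invertible matrix is its inverse. This replaces the result of
  Gauss-Jordan elimination, which is opaque, by explicit entries that can be compared with the
  adjoint of \<open>dft N\<close>.\<close>

lemma idft_eq:
  assumes "N > 0"
  shows "idft N = mat N N (\<lambda>(j, k). exp (\<i> * of_int (wavenum N k) * of_real (grid N j)))"
    (is "_ = ?G")
proof -
  have G: "?G \<in> carrier_mat N N" by simp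
  have "idft N = idft N * (dft N * ?G)"
    using idft_inverse(3)[OF assms] dft_mult_adjoint[OF assms] by simp
  also have "\<dots> = ?G"
    using assoc_mult_mat[OF idft_inverse(3)[OF assms] dft_carrier G] idft_inverse(2)[OF assms] G
    by simp
  finally show ?thesis .
qed

text \<open>Up to the factor \<open>N\<close> coming from the normalisation of the transform,
  adjoint and inverse agree: \<open>sqrt N\<close> times \<open>dft N\<close> is unitary.\<close>

lemma cnj_dft_index:
  assumes "N > 0" "j < N" "k < N"
  shows "cnj (dft N $$ (k, j)) = idft N $$ (j, k) / of_nat N"
  using assms by (simp add: idft_eq dft_def exp_cnj)

lemma dft_parseval:
  assumes N: "N > 0" and a: "a \<in> carrier_vec N" and b: "b \<in> carrier_vec N"
  shows "a \<bullet>c b = of_nat N * (\<Sum>k<N. (dft N *\<^sub>v a) $ k * cnj ((dft N *\<^sub>v b) $ k))"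
proof -
  let ?F = "dft N" and ?b = "dft N *\<^sub>v b"
  have F: "?F \<in> carrier_mat N N" by (rule dft_carrier)
  \<comment> \<open>Applying the adjoint to the transform of \<open>b\<close> is Fourier inversion
    up to the factor \<open>1/N\<close>; this sum appears once the order of summation is
    exchanged.\<close>
  have inv: "(\<Sum>k<N. cnj (?F $$ (k, j)) * ?b $ k) = b $ j / of_nat N" if "j < N" for j
  proof -
    have "idft N *\<^sub>v ?b = b"
      using assoc_mult_mat_vec[OF idft_inverse(3)[OF N] F b] idft_inverse(2)[OF N] b by simp
    hence "b $ j = (idft N *\<^sub>v ?b) $ j" by simp
    also have "\<dots> = (\<Sum>k<N. idft N $$ (j, k) * ?b $ k)"
      using that F idft_inverse(3)[OF N]
      by (simp add: scalar_prod_def lessThan_atLeast0 del: index_mult_mat_vec)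
         (simp add: scalar_prod_def lessThan_atLeast0)
    finally show ?thesis
      using N that by (simp add: cnj_dft_index sum_divide_distrib)
  qed
  have "(\<Sum>k<N. (?F *\<^sub>v a) $ k * cnj (?b $ k))
      = (\<Sum>k<N. \<Sum>j<N. ?F $$ (k, j) * a $ j * cnj (?b $ k))"
    using F a by (intro sum.cong refl)
      (simp add: scalar_prod_def sum_distrib_right lessThan_atLeast0)
  also have "\<dots> = (\<Sum>j<N. a $ j * cnj (\<Sum>k<N. cnj (?F $$ (k, j)) * ?b $ k))"
    by (subst sum.swap) (simp add: sum_distrib_left mult_ac)
  also have "\<dots> = (\<Sum>j<N. a $ j * cnj (b $ j)) / of_nat N"
    by (simp add: inv sum_divide_distrib)
  finally show ?thesis
    using N a b by (simp add: scalar_prod_def lessThan_atLeast0)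
qed

lemma mat_diag_mult_vec_index:
  fixes w :: "'a :: semiring_1 vec"
  assumes "w \<in> carrier_vec N" "k < N"
  shows "(mat_diag N m *\<^sub>v w) $ k = m k * w $ k"
proof -
  have "(mat_diag N m *\<^sub>v w) $ k = (\<Sum>i<N. (if k = i then m i else 0) * w $ i)"
    using assms by (auto simp: mat_diag_def scalar_prod_def lessThan_atLeast0)
  also have "\<dots> = (\<Sum>i<N. if k = i then m i * w $ i else 0)"
    by (intro sum.cong) auto
  finally show ?thesis using assms by simp
qed

text \<open>Both \<open>diff_mat\<close> and \<open>C_mat\<close> have this form, so each acts on
  Fourier coefficients by its symbol.\<close>

lemma dft_multiplier:
  assumes N: "N > 0" and w: "w \<in> carrier_vec N" and k: "k < N"
  shows "(dft N *\<^sub>v (idft N * mat_diag N m * dft N *\<^sub>v w)) $ k = m k * (dft N *\<^sub>v w) $ k"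
proof -
  note F = dft_carrier[of N] and G = idft_inverse[OF N]
  have D: "mat_diag N m \<in> carrier_mat N N" by simp
  have Fw: "dft N *\<^sub>v w \<in> carrier_vec N" using F w by auto
  have DFw: "mat_diag N m *\<^sub>v (dft N *\<^sub>v w) \<in> carrier_vec N"
    by (rule mult_mat_vec_carrier[OF D Fw])
  have "idft N * mat_diag N m * dft N *\<^sub>v w = idft N *\<^sub>v (mat_diag N m *\<^sub>v (dft N *\<^sub>v w))"
    using assoc_mult_mat_vec[OF mult_carrier_mat[OF G(3) D] F w]
      assoc_mult_mat_vec[OF G(3) D Fw] by simp
  moreover have "dft N *\<^sub>v (idft N *\<^sub>v (mat_diag N m *\<^sub>v (dft N *\<^sub>v w)))
      = mat_diag N m *\<^sub>v (dft N *\<^sub>v w)"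
    using assoc_mult_mat_vec[OF F G(3) DFw] G(1) DFw by simp
  ultimately show ?thesis using mat_diag_mult_vec_index[OF Fw k] by simp
qed

section \<open>The blocks in Fourier space\<close>

definition fluct_mat :: "(real \<Rightarrow> real) \<Rightarrow> nat \<Rightarrow> complex mat" where
  "fluct_mat q N = mat_diag N (\<lambda>j. complex_of_real (fluct q (grid N j)))"

lemma fluct_mat_carrier: "fluct_mat q N \<in> carrier_mat N N"
  by (simp add: fluct_mat_def)

lemma dft_add_index:
  assumes "a \<in> carrier_vec N" "b \<in> carrier_vec N" "k < N"
  shows "(dft N *\<^sub>v (a + b)) $ k = (dft N *\<^sub>v a) $ k + (dft N *\<^sub>v b) $ k"
  using assms dft_carrier[of N]
  by (simp add: mult_add_distrib_mat_vec[OF dft_carrier assms(1,2)] del: index_mult_mat_vec)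

lemma dft_smult_index:
  assumes "a \<in> carrier_vec N" "k < N"
  shows "(dft N *\<^sub>v (c \<cdot>\<^sub>v a)) $ k = c * (dft N *\<^sub>v a) $ k"
  using assms dft_carrier[of N]
  by (simp add: mult_mat_vec[OF dft_carrier assms(1)] del: index_mult_mat_vec)

lemma smult_mat_mult_vec:
  fixes A :: "'a :: comm_semiring_0 mat"
  assumes "A \<in> carrier_mat n m" "w \<in> carrier_vec m"
  shows "(c \<cdot>\<^sub>m A) *\<^sub>v w = c \<cdot>\<^sub>v (A *\<^sub>v w)"
  using assms by (intro eq_vecI) (auto simp: scalar_prod_def sum_distrib_left mult_ac)

text \<open>The term with the squared derivative matrix contributes \<open>p\<close> times the
  squared wave number, and the mean of \<open>q\<close> contributes \<open>average q\<close>.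
  Together they equal the second node, which the shift cancels exactly in row \<open>k\<close>; only
  the mean-free part of \<open>q\<close> survives.\<close>

lemma dft_L_mat:
  assumes N: "N > 0" and w: "w \<in> carrier_vec N" and k: "k < N"
  shows "(dft N *\<^sub>v ((L_mat p q N - complex_of_real (node2 p q N k) \<cdot>\<^sub>m 1\<^sub>m N) *\<^sub>v w)) $ k
    = (dft N *\<^sub>v (fluct_mat q N *\<^sub>v w)) $ k"
proof -
  let ?D = "diff_mat N" and ?l = "complex_of_real (node2 p q N k)" and ?om = "\<i> * of_int (wavenum N k)"
  let ?Q = "mat_diag N (\<lambda>j. complex_of_real (q (grid N j)))"
  have D: "?D \<in> carrier_mat N N"
    unfolding diff_mat_def using idft_inverse(3)[OF N] dft_carrier
    by (auto intro!: mult_carrier_mat[of _ N N])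
  have Dw: "?D *\<^sub>v w \<in> carrier_vec N" using D w by auto
  have DDw: "?D *\<^sub>v (?D *\<^sub>v w) \<in> carrier_vec N" using D Dw by auto
  have Fw: "fluct_mat q N *\<^sub>v w \<in> carrier_vec N" by (rule mult_mat_vec_carrier[OF fluct_mat_carrier w])
  have D2: "?D ^\<^sub>m 2 = ?D * ?D" using D by (simp add: numeral_2_eq_2)
  have DD: "?D * ?D \<in> carrier_mat N N" using D by auto
  have Qw: "?Q *\<^sub>v w = fluct_mat q N *\<^sub>v w + complex_of_real (average q) \<cdot>\<^sub>v w"
    using w unfolding fluct_mat_def
    by (intro eq_vecI)
       (auto simp: mat_diag_mult_vec_index fluct_def algebra_simps carrier_matD[OF mat_diag_dim]
         simp del: index_mult_mat_vec)
  have arith: "x + (y + complex_of_real a \<cdot>\<^sub>v w) - complex_of_real b \<cdot>\<^sub>v w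
      = x + complex_of_real (a - b) \<cdot>\<^sub>v w + y"
    if "x \<in> carrier_vec N" "y \<in> carrier_vec N" for x y a b
    using that w by (intro eq_vecI) (auto simp: left_diff_distrib)
  have "(L_mat p q N - ?l \<cdot>\<^sub>m 1\<^sub>m N) *\<^sub>v w = L_mat p q N *\<^sub>v w - ?l \<cdot>\<^sub>v w"
    using minus_mult_distrib_mat_vec[OF L_mat_carrier[OF N, of p q], of "?l \<cdot>\<^sub>m 1\<^sub>m N" w] w
    by (simp add: smult_mat_mult_vec[of _ N N])
  also have "L_mat p q N *\<^sub>v w = complex_of_real (- p) \<cdot>\<^sub>v (?D *\<^sub>v (?D *\<^sub>v w)) + ?Q *\<^sub>v w"
    unfolding L_mat_def D2 using DD w D
    by (subst add_mult_distrib_mat_vec[of _ N N])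
       (auto simp: smult_mat_mult_vec[of _ N N] assoc_mult_mat_vec[of _ N N])
  also have "\<dots> - ?l \<cdot>\<^sub>v w = (complex_of_real (- p) \<cdot>\<^sub>v (?D *\<^sub>v (?D *\<^sub>v w))
      + complex_of_real (average q - node2 p q N k) \<cdot>\<^sub>v w) + fluct_mat q N *\<^sub>v w"
    unfolding Qw using arith[OF _ Fw] DDw by simp
  finally have "(dft N *\<^sub>v ((L_mat p q N - ?l \<cdot>\<^sub>m 1\<^sub>m N) *\<^sub>v w)) $ k
      = complex_of_real (- p) * (dft N *\<^sub>v (?D *\<^sub>v (?D *\<^sub>v w))) $ k
        + complex_of_real (average q - node2 p q N k) * (dft N *\<^sub>v w) $ k
        + (dft N *\<^sub>v (fluct_mat q N *\<^sub>v w)) $ k"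
    using w Fw DDw k by (simp add: dft_add_index dft_smult_index del: index_mult_mat_vec)
  \<comment> \<open>The square of \<open>?om\<close> is minus the squared wave number, so the factor
    \<open>- p\<close> turns it into the leading term of \<open>node2\<close>.\<close>
  also have "(dft N *\<^sub>v (?D *\<^sub>v (?D *\<^sub>v w))) $ k = ?om * (?om * (dft N *\<^sub>v w) $ k)"
    using dft_multiplier[OF N Dw k] dft_multiplier[OF N w k] by (simp only: diff_mat_def)
  finally show ?thesis by (simp add: node2_def power2_eq_square algebra_simps)
qed

lemma dft_kss_block:
  assumes N: "N > 0"
  shows "kss_block p q N f \<in> carrier_mat N N"
    and "w \<in> carrier_vec N \<Longrightarrow> k < N \<Longrightarrow> (dft N *\<^sub>v (kss_block p q N f *\<^sub>v w)) $ k
      = complex_of_real (f (node2 p q N k)) * (dft N *\<^sub>v w) $ k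
        + complex_of_real (slope p q N f k) * (dft N *\<^sub>v (fluct_mat q N *\<^sub>v w)) $ k"
proof -
  have "is_kss_block p q N f (kss_block p q N f)"
    unfolding kss_block_def using kss_block_ex1[OF N] by (rule theI')
  thus "kss_block p q N f \<in> carrier_mat N N"
    and "w \<in> carrier_vec N \<Longrightarrow> k < N \<Longrightarrow> (dft N *\<^sub>v (kss_block p q N f *\<^sub>v w)) $ k
      = complex_of_real (f (node2 p q N k)) * (dft N *\<^sub>v w) $ k
        + complex_of_real (slope p q N f k) * (dft N *\<^sub>v (fluct_mat q N *\<^sub>v w)) $ k"
    by (auto simp: is_kss_block_def dft_L_mat[OF N] simp del: index_mult_mat_vec)
qed

section \<open>Action of the block operator on pairs\<close>

lemma vec_first_append: "dim_vec u = n \<Longrightarrow> vec_first (u @\<^sub>v v) n = u"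
  by (intro eq_vecI) (auto simp: vec_first_def)

lemma vec_last_append: "dim_vec v = n \<Longrightarrow> vec_last (u @\<^sub>v v) n = v"
  by (intro eq_vecI) (auto simp: vec_last_def)

lemma kss_operator_mult_vec:
  assumes N: "N > 0" and u: "u \<in> carrier_vec N" and v: "v \<in> carrier_vec N"
  shows "kss_operator p q N dt *\<^sub>v (u @\<^sub>v v)
    = (kss_block p q N (f11 dt) *\<^sub>v u + kss_block p q N (f12 dt) *\<^sub>v v) @\<^sub>v
      (kss_block p q N (f21 dt) *\<^sub>v u + kss_block p q N (f22 dt) *\<^sub>v v)"
  unfolding kss_operator_def
  by (rule four_block_mat_mult_vec) (use u v dft_kss_block(1)[OF N] in auto)

section \<open>The energy norm by modes\<close>

text \<open>By Parseval this is the Euclidean norm of \<open>w\<close> divided by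
  \<open>sqrt N\<close>.\<close>

definition dft_norm :: "nat \<Rightarrow> complex vec \<Rightarrow> real" where
  "dft_norm N w = L2_set (\<lambda>k. cmod ((dft N *\<^sub>v w) $ k)) {..<N}"

lemma Re_self_scalar_prod:
  assumes N: "N > 0" and w: "w \<in> carrier_vec N"
  shows "Re (w \<bullet>c w) = real N * (dft_norm N w)\<^sup>2"
  unfolding dft_parseval[OF N w w] dft_norm_def L2_set_def
  by (simp add: sum_nonneg complex_mult_cnj cmod_power2 del: index_mult_mat_vec)

text \<open>Multiplication by \<open>fluct q\<close> mixes Fourier modes but is diagonal on the
  grid. Parseval is therefore used twice, to leave Fourier space and to return, and the two factors
  \<open>N\<close> cancel.\<close>

lemma fluct_mat_bound:
  assumes N: "N > 0" and w: "w \<in> carrier_vec N" and s: "\<And>x. \<bar>fluct q x\<bar> \<le> s"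
  shows "dft_norm N (fluct_mat q N *\<^sub>v w) \<le> s * dft_norm N w"
proof -
  let ?Qw = "fluct_mat q N *\<^sub>v w"
  have Qw: "?Qw \<in> carrier_vec N" by (rule mult_mat_vec_carrier[OF fluct_mat_carrier w])
  have s0: "0 \<le> s" using s[of 0] by linarith
  have sq: "Re (a \<bullet>c a) = (\<Sum>j<N. (cmod (a $ j))\<^sup>2)" if "a \<in> carrier_vec N" for a
    using that by (simp add: scalar_prod_def lessThan_atLeast0 complex_mult_cnj cmod_power2)
  have "real N * (dft_norm N ?Qw)\<^sup>2 = (\<Sum>j<N. (\<bar>fluct q (grid N j)\<bar> * cmod (w $ j))\<^sup>2)"
    using Re_self_scalar_prod[OF N Qw] sq[OF Qw] w
    by (simp add: fluct_mat_def mat_diag_mult_vec_index norm_mult del: index_mult_mat_vec)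
  also have "\<dots> \<le> (\<Sum>j<N. (s * cmod (w $ j))\<^sup>2)"
    using s by (intro sum_mono power_mono mult_right_mono) auto
  also have "\<dots> = s\<^sup>2 * (real N * (dft_norm N w)\<^sup>2)"
    using Re_self_scalar_prod[OF N w] sq[OF w] by (simp add: power_mult_distrib flip: sum_distrib_left)
  finally have "(dft_norm N ?Qw)\<^sup>2 \<le> (s * dft_norm N w)\<^sup>2"
    using N by (simp add: power_mult_distrib)
  thus ?thesis
    by (rule power2_le_imp_le) (use s0 in \<open>simp add: dft_norm_def\<close>)
qed

text \<open>The weight on the first component makes the energy of a mode a Euclidean norm, in which
  the unperturbed step is an isometry.\<close>

definition mode :: "real \<Rightarrow> (real \<Rightarrow> real) \<Rightarrow> nat \<Rightarrow> complex vec \<Rightarrow> complex vec \<Rightarrow> nat \<Rightarrow> complex \<times> complex"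
  where "mode p q N u v k =
    (complex_of_real (sqrt (node2 p q N k)) * (dft N *\<^sub>v u) $ k, (dft N *\<^sub>v v) $ k)"

lemma node2_ge: "p \<ge> 0 \<Longrightarrow> average q \<le> node2 p q N k"
  by (simp add: node2_def)

lemma C_norm_modes:
  assumes N: "N > 0" and u: "u \<in> carrier_vec N" and v: "v \<in> carrier_vec N"
    and p: "p \<ge> 0" and q: "average q \<ge> 0"
  shows "C_norm p q N (u @\<^sub>v v) = sqrt (real N) * L2_set (\<lambda>k. norm (mode p q N u v k)) {..<N}"
proof -
  have l: "node2 p q N k \<ge> 0" for k using node2_ge[OF p, of q N k] q by linarith
  have Cu: "C_mat p q N *\<^sub>v u \<in> carrier_vec N"
    unfolding C_mat_def
    by (intro mult_mat_vec_carrier[OF _ u] mult_carrier_mat[of _ N N] idft_inverse(3)[OF N]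
        dft_carrier mat_diag_dim)
  have "(C_mat p q N *\<^sub>v u) \<bullet>c u
      = of_nat N * (\<Sum>k<N. complex_of_real (node2 p q N k) * (dft N *\<^sub>v u) $ k * cnj ((dft N *\<^sub>v u) $ k))"
    unfolding dft_parseval[OF N Cu u]
    by (simp add: C_mat_def dft_multiplier[OF N u] node2_def del: index_mult_mat_vec)
  also have "\<dots> = complex_of_real (real N * (\<Sum>k<N. node2 p q N k * (cmod ((dft N *\<^sub>v u) $ k))\<^sup>2))"
    by (simp add: complex_norm_square[symmetric] mult.assoc del: index_mult_mat_vec)
  finally have C: "Re ((C_mat p q N *\<^sub>v u) \<bullet>c u)
      = real N * (\<Sum>k<N. node2 p q N k * (cmod ((dft N *\<^sub>v u) $ k))\<^sup>2)"
    by simp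
  have V: "Re (v \<bullet>c v) = real N * (\<Sum>k<N. (cmod ((dft N *\<^sub>v v) $ k))\<^sup>2)"
    unfolding Re_self_scalar_prod[OF N v] dft_norm_def L2_set_def by (simp add: sum_nonneg)
  have "C_norm p q N (u @\<^sub>v v)
      = sqrt (real N * (\<Sum>k<N. node2 p q N k * (cmod ((dft N *\<^sub>v u) $ k))\<^sup>2
          + (cmod ((dft N *\<^sub>v v) $ k))\<^sup>2))"
    using u v C V by (simp add: C_norm_def vec_first_append vec_last_append sum.distrib distrib_left
        del: index_mult_mat_vec)
  also have "\<dots> = sqrt (real N) * L2_set (\<lambda>k. norm (mode p q N u v k)) {..<N}"
    using l by (simp add: L2_set_def mode_def norm_Pair norm_mult power_mult_distrib real_sqrt_mult
        del: index_mult_mat_vec)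
  finally show ?thesis .
qed

text \<open>The energy weights the first component by \<open>sqrt (node2 p q N k)\<close>, which is
  at least \<open>sqrt (average q)\<close> in every mode. Positivity of the mean thus controls
  \<open>u\<close> itself, including its mode of wave number zero.\<close>

lemma dft_norm_le_mode:
  assumes p: "p \<ge> 0" and q: "average q > 0"
  shows "dft_norm N u \<le> L2_set (\<lambda>k. norm (mode p q N u v k)) {..<N} / sqrt (average q)"
    and "dft_norm N v \<le> L2_set (\<lambda>k. norm (mode p q N u v k)) {..<N}"
proof -
  have "cmod ((dft N *\<^sub>v u) $ k) * sqrt (average q) \<le> norm (mode p q N u v k)" for k
  proof -
    have "cmod ((dft N *\<^sub>v u) $ k) * sqrt (average q)
        \<le> cmod ((dft N *\<^sub>v u) $ k) * sqrt (node2 p q N k)"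
      using node2_ge[OF p, of q N k] by (intro mult_left_mono) auto
    also have "\<dots> = norm (fst (mode p q N u v k))"
      using node2_ge[OF p, of q N k] q
      by (simp add: mode_def norm_mult mult_ac del: index_mult_mat_vec)
    also have "\<dots> \<le> norm (mode p q N u v k)"
      unfolding mode_def fst_conv by (rule norm_fst_le)
    finally show ?thesis .
  qed
  hence "dft_norm N u * sqrt (average q) \<le> L2_set (\<lambda>k. norm (mode p q N u v k)) {..<N}"
    unfolding dft_norm_def using q by (subst L2_set_left_distrib) (auto intro!: L2_set_mono)
  thus "dft_norm N u \<le> L2_set (\<lambda>k. norm (mode p q N u v k)) {..<N} / sqrt (average q)"
    using q by (simp add: pos_le_divide_eq)
  have "norm (snd (mode p q N u v k)) \<le> norm (mode p q N u v k)" for k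
    unfolding mode_def snd_conv by (rule norm_snd_le)
  thus "dft_norm N v \<le> L2_set (\<lambda>k. norm (mode p q N u v k)) {..<N}"
    unfolding dft_norm_def by (intro L2_set_mono) (auto simp: mode_def simp del: index_mult_mat_vec)
qed

section \<open>One step of the method\<close>

text \<open>For real \<open>c\<close> and \<open>s\<close> the cross terms in \<open>a\<close> and
  \<open>b\<close> cancel between the two squared moduli.\<close>

lemma norm_rotation:
  fixes a b :: complex
  assumes "c\<^sup>2 + s\<^sup>2 = (1::real)"
  shows "norm (of_real c * a + of_real s * b, of_real c * b - of_real s * a) = norm (a, b)"
proof -
  have "(cmod (of_real c * a + of_real s * b))\<^sup>2 + (cmod (of_real c * b - of_real s * a))\<^sup>2
      = (c\<^sup>2 + s\<^sup>2) * ((cmod a)\<^sup>2 + (cmod b)\<^sup>2)"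
    by (simp add: cmod_power2) (simp add: power2_eq_square algebra_simps)
  thus ?thesis using assms by (simp add: norm_Pair)
qed

text \<open>By the half-angle formula \<open>1 - cos x\<close> is twice the square of
  \<open>sin (x / 2)\<close>; one factor is bounded by \<open>x / 2\<close>, the other by 1.\<close>

lemma abs_cos_minus_one_le: "x \<ge> 0 \<Longrightarrow> \<bar>cos x - 1\<bar> \<le> (x::real)"
proof -
  assume x: "x \<ge> 0"
  have "\<bar>cos x - 1\<bar> = 2 * (\<bar>sin (x / 2)\<bar> * \<bar>sin (x / 2)\<bar>)"
    using cos_double_sin[of "x / 2"] by (simp add: power2_eq_square)
  also have "\<dots> \<le> 2 * (\<bar>x / 2\<bar> * 1)"
    by (intro mult_left_mono mult_mono abs_sin_x_le_abs_x abs_sin_le_one) auto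
  finally show ?thesis using x by simp
qed

text \<open>The slopes of \<open>f11\<close> and \<open>f12\<close> feed the first component of
  \<open>mode\<close>, hence their extra factor \<open>r\<close>. After this weighting every bound
  is linear in \<open>dt\<close> and does not grow with the wave number.\<close>

lemma slope_bounds:
  fixes dt :: real
  assumes l: "node2 p q N k > 0" and dt: "dt \<ge> 0"
  defines "r \<equiv> sqrt (node2 p q N k)"
  shows "r * \<bar>slope p q N (f11 dt) k\<bar> \<le> dt"
    and "r * \<bar>slope p q N (f12 dt) k\<bar> \<le> 2 * dt / r"
    and "\<bar>slope p q N (f21 dt) k\<bar> \<le> dt"
    and "\<bar>slope p q N (f22 dt) k\<bar> \<le> dt / r"
proof -
  have r: "r > 0" and lr: "node2 p q N k = r * r" using l by (auto simp: r_def)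
  have x: "r * dt \<ge> 0" using r dt by simp
  have c: "\<bar>cos (r * dt) - 1\<bar> \<le> r * dt" and s: "\<bar>sin (r * dt)\<bar> \<le> r * dt"
    using abs_cos_minus_one_le[OF x] abs_sin_x_le_abs_x[of "r * dt"] x by auto
  have "slope p q N (f11 dt) k = (cos (r * dt) - 1) / (r * r)"
    "slope p q N (f22 dt) k = (cos (r * dt) - 1) / (r * r)"
    using r by (simp_all add: slope_def f11_def f22_def node1_def lr)
  hence "r * \<bar>slope p q N (f11 dt) k\<bar> = \<bar>cos (r * dt) - 1\<bar> / r"
    "\<bar>slope p q N (f22 dt) k\<bar> = \<bar>cos (r * dt) - 1\<bar> / r / r"
    using r by (simp_all add: abs_mult)
  thus "r * \<bar>slope p q N (f11 dt) k\<bar> \<le> dt" "\<bar>slope p q N (f22 dt) k\<bar> \<le> dt / r"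
    using c r by (simp_all add: pos_divide_le_eq mult.commute)
  \<comment> \<open>The subtracted term is the limit value \<open>dt\<close> of \<open>f12\<close>
    at the node 0. The triangle inequality then gives the crude bound \<open>2 * (r * dt)\<close>
    for the numerator.\<close>
  have "slope p q N (f12 dt) k = (sin (r * dt) - r * dt) / (r * r * r)"
    using r by (simp add: slope_def f12_def node1_def lr field_simps)
  hence "r * \<bar>slope p q N (f12 dt) k\<bar> = \<bar>sin (r * dt) - r * dt\<bar> / (r * r)"
    using r by (simp add: abs_mult)
  also have "\<dots> \<le> 2 * (r * dt) / (r * r)"
    using s r by (intro divide_right_mono) (linarith, simp)
  finally show "r * \<bar>slope p q N (f12 dt) k\<bar> \<le> 2 * dt / r"
    using r by simp
  have "slope p q N (f21 dt) k = - sin (r * dt) / r"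
    using r by (simp add: slope_def f21_def f12_def node1_def lr)
  thus "\<bar>slope p q N (f21 dt) k\<bar> \<le> dt"
    using s r by (simp add: pos_divide_le_eq mult.commute)
qed

text \<open>The new mode is the old one rotated, plus one perturbation from \<open>u\<close> and one
  from \<open>v\<close>. The constants are sums of slope bounds: 2 = 1 + 1 from \<open>f11\<close>
  and \<open>f21\<close>, and 3 = 2 + 1 from \<open>f12\<close> and \<open>f22\<close>.\<close>

lemma norm_mode_step_le:
  assumes N: "N > 0" and u: "u \<in> carrier_vec N" and v: "v \<in> carrier_vec N" and k: "k < N"
    and p: "p \<ge> 0" and q: "average q > 0" and dt: "dt \<ge> 0"
  shows "norm (mode p q N (kss_block p q N (f11 dt) *\<^sub>v u + kss_block p q N (f12 dt) *\<^sub>v v)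
        (kss_block p q N (f21 dt) *\<^sub>v u + kss_block p q N (f22 dt) *\<^sub>v v) k)
    \<le> norm (mode p q N u v k)
      + (2 * dt * cmod ((dft N *\<^sub>v (fluct_mat q N *\<^sub>v u)) $ k)
        + 3 * dt / sqrt (average q) * cmod ((dft N *\<^sub>v (fluct_mat q N *\<^sub>v v)) $ k))"
proof -
  define r where "r = sqrt (node2 p q N k)"
  define x where "x = r * dt"
  define a where "a = (dft N *\<^sub>v u) $ k"
  define b where "b = (dft N *\<^sub>v v) $ k"
  define g where "g = (dft N *\<^sub>v (fluct_mat q N *\<^sub>v u)) $ k"
  define h where "h = (dft N *\<^sub>v (fluct_mat q N *\<^sub>v v)) $ k"
  define M where "M f = slope p q N f k" for f
  have l: "node2 p q N k > 0" using node2_ge[OF p, of q N k] q by linarith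
  have r: "r > 0" and lr: "node2 p q N k = r * r" using l by (auto simp: r_def)
  have r2: "sqrt (r * r) = r" using r by simp
  have rq: "sqrt (average q) \<le> r" using node2_ge[OF p, of q N k] by (simp add: r_def)
  \<comment> \<open>The last two identities make the off-diagonal entries \<open>sin x\<close> and
    \<open>- sin x\<close> once the first component carries the weight \<open>r\<close>.\<close>
  have f: "f11 dt (node2 p q N k) = cos x" "f22 dt (node2 p q N k) = cos x"
    "f21 dt (node2 p q N k) = - (r * r * f12 dt (node2 p q N k))"
    "sin x = r * f12 dt (node2 p q N k)"
    using r by (simp_all add: f11_def f12_def f21_def f22_def lr r2 x_def)
  have B: "kss_block p q N f *\<^sub>v w \<in> carrier_vec N" if "w \<in> carrier_vec N" for f w
    using dft_kss_block(1)[OF N, of p q f] that by auto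
  have "mode p q N (kss_block p q N (f11 dt) *\<^sub>v u + kss_block p q N (f12 dt) *\<^sub>v v)
        (kss_block p q N (f21 dt) *\<^sub>v u + kss_block p q N (f22 dt) *\<^sub>v v) k
      = (of_real (cos x) * (of_real r * a) + of_real (sin x) * b,
         of_real (cos x) * b - of_real (sin x) * (of_real r * a))
        + ((of_real (r * M (f11 dt)) * g, of_real (M (f21 dt)) * g)
        + (of_real (r * M (f12 dt)) * h, of_real (M (f22 dt)) * h))"
    unfolding mode_def dft_add_index[OF B[OF u] B[OF v] k] dft_kss_block(2)[OF N u k]
      dft_kss_block(2)[OF N v k] a_def[symmetric] b_def[symmetric] g_def[symmetric]
      h_def[symmetric] M_def[symmetric] r_def[symmetric]
    by (simp add: f distrib_left mult_ac)
  hence "norm (mode p q N (kss_block p q N (f11 dt) *\<^sub>v u + kss_block p q N (f12 dt) *\<^sub>v v)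
        (kss_block p q N (f21 dt) *\<^sub>v u + kss_block p q N (f22 dt) *\<^sub>v v) k)
      \<le> norm (of_real (cos x) * (of_real r * a) + of_real (sin x) * b,
         of_real (cos x) * b - of_real (sin x) * (of_real r * a))
        + (norm (of_real (r * M (f11 dt)) * g, of_real (M (f21 dt)) * g)
        + norm (of_real (r * M (f12 dt)) * h, of_real (M (f22 dt)) * h))"
    by (simp only:) (intro norm_triangle_le add_mono order_refl norm_triangle_ineq)
  also have "norm (of_real (cos x) * (of_real r * a) + of_real (sin x) * b,
         of_real (cos x) * b - of_real (sin x) * (of_real r * a))
      = norm (mode p q N u v k)"
    by (subst norm_rotation) (simp_all add: mode_def r_def a_def b_def)
  also have "norm (of_real (r * M (f11 dt)) * g, of_real (M (f21 dt)) * g) \<le> 2 * dt * cmod g"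
  proof -
    have "norm (of_real (r * M (f11 dt)) * g, of_real (M (f21 dt)) * g)
        \<le> (r * \<bar>M (f11 dt)\<bar> + \<bar>M (f21 dt)\<bar>) * cmod g"
      using r by (intro order_trans[OF norm_Pair_le]) (simp add: norm_mult abs_mult algebra_simps)
    also have "\<dots> \<le> 2 * dt * cmod g"
      using slope_bounds(1,3)[OF l dt] unfolding r_def[symmetric] M_def[symmetric]
      by (intro mult_right_mono) auto
    finally show ?thesis .
  qed
  also have "norm (of_real (r * M (f12 dt)) * h, of_real (M (f22 dt)) * h)
      \<le> 3 * dt / sqrt (average q) * cmod h"
  proof -
    have "norm (of_real (r * M (f12 dt)) * h, of_real (M (f22 dt)) * h)
        \<le> (r * \<bar>M (f12 dt)\<bar> + \<bar>M (f22 dt)\<bar>) * cmod h"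
      using r by (intro order_trans[OF norm_Pair_le]) (simp add: norm_mult abs_mult algebra_simps)
    also have "\<dots> \<le> (2 * dt / r + dt / r) * cmod h"
      using slope_bounds(2,4)[OF l dt] unfolding r_def[symmetric] M_def[symmetric]
      by (intro mult_right_mono add_mono) auto
    also have "2 * dt / r + dt / r = 3 * dt / r" by (simp add: field_simps)
    \<comment> \<open>The lower bound for \<open>r\<close> removes the dependence on the
      mode.\<close>
    also have "3 * dt / r * cmod h \<le> 3 * dt / sqrt (average q) * cmod h"
      using rq q dt r by (intro mult_right_mono divide_left_mono) auto
    finally show ?thesis .
  qed
  finally show ?thesis by (simp add: g_def h_def)
qed

text \<open>Minkowski's inequality sums the estimates over the modes. Only after this summation can
  the perturbation be bounded by \<open>s\<close>, since \<open>fluct_mat_bound\<close> concerns all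
  modes together.\<close>

lemma C_norm_kss_step_le:
  assumes N: "N > 0" and z: "z \<in> carrier_vec (2 * N)"
    and p: "p \<ge> 0" and q: "average q > 0" and dt: "dt \<ge> 0" and s: "\<And>x. \<bar>fluct q x\<bar> \<le> s"
  shows "C_norm p q N (kss_operator p q N dt *\<^sub>v z)
    \<le> (1 + 5 / sqrt (average q) * s * dt) * C_norm p q N z"
proof -
  define u where "u = vec_first z N"
  define v where "v = vec_last z N"
  have u: "u \<in> carrier_vec N" and v: "v \<in> carrier_vec N" by (auto simp: u_def v_def)
  have uv: "z = u @\<^sub>v v" using z by (simp add: u_def v_def mult_2)
  have B: "kss_block p q N f *\<^sub>v w \<in> carrier_vec N" if "w \<in> carrier_vec N" for f w
    using dft_kss_block(1)[OF N, of p q f] that by auto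
  define u' where "u' = kss_block p q N (f11 dt) *\<^sub>v u + kss_block p q N (f12 dt) *\<^sub>v v"
  define v' where "v' = kss_block p q N (f21 dt) *\<^sub>v u + kss_block p q N (f22 dt) *\<^sub>v v"
  have u': "u' \<in> carrier_vec N" and v': "v' \<in> carrier_vec N"
    using B u v by (auto simp: u'_def v'_def)
  have s0: "0 \<le> s" using s[of 0] by linarith
  let ?g = "\<lambda>k. 2 * dt * cmod ((dft N *\<^sub>v (fluct_mat q N *\<^sub>v u)) $ k)"
  let ?h = "\<lambda>k. 3 * dt / sqrt (average q) * cmod ((dft N *\<^sub>v (fluct_mat q N *\<^sub>v v)) $ k)"
  let ?E = "L2_set (\<lambda>k. norm (mode p q N u v k)) {..<N}"
  have "L2_set (\<lambda>k. norm (mode p q N u' v' k)) {..<N}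
      \<le> L2_set (\<lambda>k. norm (mode p q N u v k) + (?g k + ?h k)) {..<N}"
    using norm_mode_step_le[OF N u v _ p q dt] unfolding u'_def v'_def
    by (intro L2_set_mono) auto
  also have "\<dots> \<le> ?E + (L2_set ?g {..<N} + L2_set ?h {..<N})"
    by (intro order_trans[OF L2_set_triangle_ineq] add_mono order_refl L2_set_triangle_ineq)
  also have "L2_set ?g {..<N} = 2 * dt * dft_norm N (fluct_mat q N *\<^sub>v u)"
    unfolding dft_norm_def using dt by (intro L2_set_right_distrib[symmetric]) simp
  also have "L2_set ?h {..<N} = 3 * dt / sqrt (average q) * dft_norm N (fluct_mat q N *\<^sub>v v)"
    unfolding dft_norm_def using dt q by (intro L2_set_right_distrib[symmetric]) simp
  also have "dft_norm N (fluct_mat q N *\<^sub>v u) \<le> s * (?E / sqrt (average q))"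
    using fluct_mat_bound[OF N u s] dft_norm_le_mode(1)[OF p q, of N u v] s0
    by (meson mult_left_mono order_trans)
  also have "dft_norm N (fluct_mat q N *\<^sub>v v) \<le> s * ?E"
    using fluct_mat_bound[OF N v s] dft_norm_le_mode(2)[OF p q, of N v u] s0
    by (meson mult_left_mono order_trans)
  \<comment> \<open>Both perturbations now carry the same factor
    \<open>1 / sqrt (average q)\<close>, so the constants add to 5 = 2 + 3.\<close>
  also have "?E + (2 * dt * (s * (?E / sqrt (average q))) + 3 * dt / sqrt (average q) * (s * ?E))
      = (1 + 5 / sqrt (average q) * s * dt) * ?E"
    using q by (simp add: field_simps)
  finally have main: "L2_set (\<lambda>k. norm (mode p q N u' v' k)) {..<N}
      \<le> (1 + 5 / sqrt (average q) * s * dt) * ?E"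
    using dt q by (simp add: mult_left_mono divide_right_mono)
  have "C_norm p q N (kss_operator p q N dt *\<^sub>v z)
      = sqrt (real N) * L2_set (\<lambda>k. norm (mode p q N u' v' k)) {..<N}"
    unfolding uv kss_operator_mult_vec[OF N u v] u'_def[symmetric] v'_def[symmetric]
    using C_norm_modes[OF N u' v' p] q by simp
  also have "\<dots> \<le> sqrt (real N) * ((1 + 5 / sqrt (average q) * s * dt) * ?E)"
    using main by (intro mult_left_mono) auto
  also have "\<dots> = (1 + 5 / sqrt (average q) * s * dt) * C_norm p q N z"
    unfolding uv using C_norm_modes[OF N u v p] q by (simp add: mult_ac)
  finally show ?thesis .
qed

section \<open>Boundedness of the fluctuation and passage to the operator norm\<close>

text \<open>Compactness of one period gives a bound there, and translation by whole periods spreads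
  it to the line. A real supremum is an upper bound only for a set bounded above, so
  \<open>sup_norm\<close> requires this.\<close>

lemma periodic_continuous_bdd:
  fixes f :: "real \<Rightarrow> real"
  assumes per: "\<And>x. f (x + 2 * pi) = f x" and cont: "continuous_on UNIV f"
  shows "bdd_above (range (\<lambda>x. \<bar>f x\<bar>))"
proof -
  have "compact (f ` {0..2*pi})"
    by (intro compact_continuous_image continuous_on_subset[OF cont]) auto
  then obtain B where B: "\<And>x. x \<in> {0..2*pi} \<Longrightarrow> \<bar>f x\<bar> \<le> B"
    using compact_imp_bounded bounded_iff by (metis imageI real_norm_def)
  have shift: "f (x + of_int n * (2 * pi)) = f x" for n x
  proof (induction n rule: int_induct[where k = 0])
    case (step1 i)
    thus ?case using per[of "x + of_int i * (2 * pi)"] by (simp add: algebra_simps)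
  next
    case (step2 i)
    thus ?case using per[of "x + of_int (i - 1) * (2 * pi)"] by (simp add: algebra_simps)
  qed simp
  have "\<bar>f x\<bar> \<le> B" for x
  proof -
    have "x - of_int \<lfloor>x / (2 * pi)\<rfloor> * (2 * pi) \<in> {0..2*pi}"
      using floor_divide_lower[of "2 * pi" x] floor_divide_upper[of "2 * pi" x]
      by (simp add: algebra_simps)
    from B[OF this] show ?thesis
      using shift[of x "- \<lfloor>x / (2 * pi)\<rfloor>"] by simp
  qed
  thus ?thesis by (auto intro!: bdd_aboveI)
qed

theorem theorem4p1:
  fixes p :: real and q :: "real \<Rightarrow> real"
  assumes "p > 0"
    and "\<And>x. q (x + 2 * pi) = q x"
    and "\<And>x. q x \<ge> 0"
    and "average q > 0"
    and "second_deriv_piecewise_C1 q"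
  shows "\<exists>C_q::real. \<forall>(N::nat) (dt::real). even N \<and> N > 0 \<and> dt > 0 \<longrightarrow>
           C_opnorm p q N (kss_operator p q N dt) \<le> 1 + C_q * sup_norm (fluct q) * dt"
proof (intro exI allI impI)
  fix N :: nat and dt :: real
  assume "even N \<and> N > 0 \<and> dt > 0"
  hence N: "N > 0" and dt: "dt \<ge> 0" by auto
  have "continuous_on UNIV q"
    using assms(5) unfolding second_deriv_piecewise_C1_def
    by (meson DERIV_isCont continuous_at_imp_continuous_on)
  hence "continuous_on UNIV (fluct q)"
    unfolding fluct_def by (intro continuous_intros)
  hence "bdd_above (range (\<lambda>x. \<bar>fluct q x\<bar>))"
    using assms(2) by (intro periodic_continuous_bdd) (simp_all add: fluct_def)
  hence s: "\<bar>fluct q x\<bar> \<le> sup_norm (fluct q)" for x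
    unfolding sup_norm_def by (rule cSUP_upper[OF UNIV_I])
  let ?b = "1 + 5 / sqrt (average q) * sup_norm (fluct q) * dt"
  have b: "0 \<le> ?b" using s[of 0] dt assms(4) by (intro add_nonneg_nonneg mult_nonneg_nonneg) auto
  \<comment> \<open>A witness that the supremum in \<open>C_opnorm\<close> ranges over a nonempty
    set, so that bounding each quotient bounds the supremum.\<close>
  have "unit_vec (2 * N) 0 \<in> carrier_vec (2 * N) - {0\<^sub>v (2 * N) :: complex vec}"
    using N by (auto dest!: arg_cong[of _ _ "\<lambda>v. v $ 0"])
  thus "C_opnorm p q N (kss_operator p q N dt) \<le> ?b"
    unfolding C_opnorm_def
  proof (intro cSUP_least)
    fix z :: "complex vec" assume "z \<in> carrier_vec (2 * N) - {0\<^sub>v (2 * N)}"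
    hence z: "z \<in> carrier_vec (2 * N)" by simp
    have "C_norm p q N z \<ge> 0"
      using z N assms(1,4) C_norm_modes[OF N, of "vec_first z N" "vec_last z N" p q]
      by (simp add: mult_2)
    \<comment> \<open>If the denominator is zero, the quotient is 0 by convention and
      \<open>?b\<close> is nonnegative; otherwise the one-step estimate is divided by a positive
      norm.\<close>
    thus "C_norm p q N (kss_operator p q N dt *\<^sub>v z) / C_norm p q N z \<le> ?b"
      using C_norm_kss_step_le[OF N z _ assms(4) dt s, of p] assms(1) b
      by (cases "C_norm p q N z = 0") (auto simp: pos_divide_le_eq)
  qed blast
qed

end
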